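(* Let $r,n\in\mathbb{N}$, let $c_1,\ldots,c_r$ be pairwise distinct real numbers, let $j=\mathrm{diag}\{I_{m_1},-I_{m_2}\}$ with $m_1,m_2\in\mathbb{N}\cup\{0\}$, $m=m_1+m_2>0$, and let $\beta_k(x)$ ($1\le k\le r$) be $p\times m$ matrix functions ($p\le m$) on an interval $\mathcal I\ni0$ such that $H_k(x)=\beta_k(x)^*\beta_k(x)$ are locally summable. Let a triple $\{A,S(0),\Pi(0)\}$ with $A,S(0)\in\mathbb{C}^{n\times n}$, $\Pi(0)\in\mathbb{C}^{n\times m}$ satisfy $c_k\notin\sigma(A)$ for $1\le k\le r$ and $$AS(0)-S(0)A^*=\mathrm{i}\,\Pi(0)j\Pi(0)^*,\qquad S(0)=S(0)^*,$$ and let $\Pi(x)$, $S(x)$ (with these initial values) satisfy on $\mathcal I$ $$\Pi'(x)=-\mathrm{i}\sum_{k=1}^r(A-c_kI_n)^{-1}\Pi(x)jH_k(x),$$ $$S'(x)=-\sum_{k=1}^r(A-c_kI_n)^{-1}\Pi(x)jH_k(x)j\Pi(x)^*(A^*-c_kI_n)^{-1}.$$ Then, at the points of invertibility of $S(x)$, $$\big(\Pi(x)^*S(x)^{-1}\Pi(x)\big)'=\sum_{k=1}^r\big(\widetilde H_k(x)-H_k(x)\big),$$ where $$\widetilde H_k(x)=\widetilde\beta_k(x)^*\widetilde\beta_k(x),\quad \widetilde\beta_k(x)=\beta_k(x)\,j\,w_A(x,c_k)^*j,\quad w_A(x,z)=I_m-\mathrm{i}\,j\Pi(x)^*S(x)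^{-1}(A-zI_n)^{-1}\Pi(x).$$
   Context: $'$ denotes $d/dx$; since the coefficients $H_k$ are only locally summable, the differential equations in $x$ are understood for absolutely continuous matrix functions and almost everywhere in $x$. $I_q$ is the $q\times q$ identity, $M^*$ the conjugate transpose, $\sigma(A)$ the spectrum of $A$. *)

theory Defs
  imports "HOL-Analysis.Analysis"
begin

definition scaleCM :: "complex \<Rightarrow> complex^'n^'m \<Rightarrow> complex^'n^'m" (infixr "*\<^sub>C" 75) where
  "c *\<^sub>C M = map_matrix (\<lambda>z. c * z) M"

definition ctranspose :: "complex^'n^'m \<Rightarrow> complex^'m^'n" where
  "ctranspose M = map_matrix cnj (transpose M)"

definition mspectrum :: "complex^'n^'n \<Rightarrow> complex set" where
  "mspectrum A = {z. \<exists>v. v \<noteq> 0 \<and> A *v v = z *s v}"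

text \<open>The block matrix \<open>diag {I, -I}\<close> with blocks of sizes \<open>m1\<close> and \<open>CARD('m) - m1\<close>.
  The order on the index type fixes which indices come first: \<open>card {b. b < a}\<close> is the
  position of the index \<open>a\<close>, counted from 0. Either block may be empty.\<close>

definition sig_mat :: "nat \<Rightarrow> complex^('m::{finite,linorder})^('m::{finite,linorder})" where
  "sig_mat m1 =
     (\<chi> a b. if a = b then (if card {b. b < a} < m1 then 1 else -1) else 0)"

text \<open>In dimension one a division is a finite family of nonoverlapping compact intervals
  \<open>{Inf K..Sup K}\<close>, and \<open>measure lborel K\<close> is the length of \<open>K\<close>.\<close>

definition abs_cont_on :: "real set \<Rightarrow> (real \<Rightarrow> 'a::real_normed_vector) \<Rightarrow> bool" where
  "abs_cont_on T f \<longleftrightarrow>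
     (\<forall>\<epsilon>>0. \<exists>\<delta>>0. \<forall>\<D> t. \<D> division_of t \<and> t \<subseteq> T \<and> (\<Sum>K\<in>\<D>. measure lborel K) < \<delta>
        \<longrightarrow> (\<Sum>K\<in>\<D>. norm (f (Sup K) - f (Inf K))) < \<epsilon>)"

definition loc_abs_cont_on :: "real set \<Rightarrow> (real \<Rightarrow> 'a::real_normed_vector) \<Rightarrow> bool" where
  "loc_abs_cont_on X f \<longleftrightarrow> (\<forall>a b. {a..b} \<subseteq> X \<longrightarrow> abs_cont_on {a..b} f)"

definition loc_summable_on :: "real set \<Rightarrow> (real \<Rightarrow> 'a::euclidean_space) \<Rightarrow> bool" where
  "loc_summable_on X f \<longleftrightarrow> (\<forall>a b. {a..b} \<subseteq> X \<longrightarrow> f absolutely_integrable_on {a..b})"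

text \<open>A differential equation \<open>f' = g\<close> on \<open>X\<close> in the Caratheodory sense: \<open>f\<close> is (locally)
  absolutely continuous and the equation holds almost everywhere.\<close>

definition ae_ode_on ::
  "real set \<Rightarrow> (real \<Rightarrow> 'a::real_normed_vector) \<Rightarrow> (real \<Rightarrow> 'a) \<Rightarrow> bool" where
  "ae_ode_on X f g \<longleftrightarrow> loc_abs_cont_on X f \<and>
     (AE x in lebesgue. x \<in> X \<longrightarrow> (f has_vector_derivative g x) (at x within X))"

definition gram :: "complex^'m^'p \<Rightarrow> complex^'m^'m" where
  "gram B = ctranspose B ** B"

text \<open>The transfer matrix function \<open>w\<^sub>A(z)\<close>, for given values \<open>S\<close>, \<open>P\<close> of \<open>S(x)\<close>, \<open>\<Pi>(x)\<close>.\<close>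

definition transfer_mat ::
  "complex^'n^'n \<Rightarrow> complex^'m^'m \<Rightarrow> complex^'n^'n \<Rightarrow> complex^'m^'n \<Rightarrow> complex \<Rightarrow> complex^'m^'m"
  where
  "transfer_mat A j S P z =
     mat 1 - \<i> *\<^sub>C (j ** ctranspose P ** matrix_inv S ** matrix_inv (A - mat z) ** P)"

definition beta_tilde ::
  "complex^'n^'n \<Rightarrow> complex^'m^'m \<Rightarrow> complex^'n^'n \<Rightarrow> complex^'m^'n \<Rightarrow> complex
     \<Rightarrow> complex^'m^'p \<Rightarrow> complex^'m^'p"
  where
  "beta_tilde A j S P z B = B ** j ** ctranspose (transfer_mat A j S P z) ** j"

end

theory Submission
  imports Defs
begin

text \<open>
  Write \<open>X = S\<^sup>-\<^sup>1\<close> and \<open>R\<^sub>k = (A - c\<^sub>k I)\<^sup>-\<^sup>1\<close>. Since \<open>c\<^sub>k\<close> is real, the adjoint of \<open>R\<^sub>k\<close> is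
  \<open>(A\<^sup>* - c\<^sub>k I)\<^sup>-\<^sup>1\<close>, and since \<open>j\<close> and \<open>H\<^sub>k\<close> are Hermitian, so is the right-hand side of the equation
  for \<open>S\<close>. Hence \<open>S - S\<^sup>*\<close> is absolutely continuous with derivative zero almost everywhere; it
  vanishes at \<open>0\<close>, so \<open>S\<close> is Hermitian on the whole interval. Where \<open>S\<close> is invertible, the product
  rule and \<open>X' = - X S' X\<close> give \<open>(P\<^sup>* X P)'\<close> as the sum over \<open>k\<close> of
  \<open>i H\<^sub>k j P\<^sup>* R\<^sub>k\<^sup>* X P - i P\<^sup>* X R\<^sub>k P j H\<^sub>k + P\<^sup>* X R\<^sub>k P j H\<^sub>k j P\<^sup>* R\<^sub>k\<^sup>* X P\<close>.
  Because \<open>X\<^sup>* = X\<close> and \<open>j\<^sup>2 = I\<close>, the matrix \<open>j w\<^sub>A(c\<^sub>k)\<^sup>* j\<close> is \<open>I + i j P\<^sup>* R\<^sub>k\<^sup>* X P\<close>, and expanding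
  \<open>(I + i j P\<^sup>* R\<^sub>k\<^sup>* X P)\<^sup>* H\<^sub>k (I + i j P\<^sup>* R\<^sub>k\<^sup>* X P) - H\<^sub>k\<close> produces exactly the same three terms
  (\<open>gram_beta_tilde_minus_gram\<close>).

  The analytic content is a calculus of Caratheodory derivatives: absolute continuity together with
  an almost everywhere derivative passes through bounded linear maps (\<open>ae_ode_on_linear\<close>), bilinear
  products (\<open>ae_ode_on_bilinear\<close>) and matrix inversion (\<open>ae_ode_on_matrix_inv\<close>), and a zero
  derivative forces constancy on intervals (\<open>ae_ode_on_zero_imp_constant\<close>).
\<close>

section \<open>Algebra of complex matrices and adjoints\<close>

lemma bounded_bilinear_matrix_mult:
  "bounded_bilinear ((**) :: complex^'b^'a \<Rightarrow> complex^'c^'b \<Rightarrow> complex^'c^'a)"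
proof -
  have "bilinear ((**) :: complex^'b^'a \<Rightarrow> complex^'c^'b \<Rightarrow> complex^'c^'a)"
    unfolding bilinear_def
    by (auto intro!: linearI simp: vec_eq_iff matrix_matrix_mult_def algebra_simps
        sum.distrib scaleR_sum_right)
  then show ?thesis
    by (simp add: bilinear_conv_bounded_bilinear)
qed

lemmas matrix_mult_add_left = bounded_bilinear.add_left[OF bounded_bilinear_matrix_mult]
  and matrix_mult_add_right = bounded_bilinear.add_right[OF bounded_bilinear_matrix_mult]
  and matrix_mult_diff_left = bounded_bilinear.diff_left[OF bounded_bilinear_matrix_mult]
  and matrix_mult_diff_right = bounded_bilinear.diff_right[OF bounded_bilinear_matrix_mult]
  and matrix_mult_minus_left = bounded_bilinear.minus_left[OF bounded_bilinear_matrix_mult]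
  and matrix_mult_minus_right = bounded_bilinear.minus_right[OF bounded_bilinear_matrix_mult]
  and matrix_mult_sum_left = bounded_bilinear.sum_left[OF bounded_bilinear_matrix_mult]
  and matrix_mult_sum_right = bounded_bilinear.sum_right[OF bounded_bilinear_matrix_mult]

lemma bounded_linear_ctranspose:
  "bounded_linear (ctranspose :: complex^'a^'b \<Rightarrow> complex^'b^'a)"
  unfolding linear_conv_bounded_linear[symmetric]
  by (auto intro!: linearI simp: vec_eq_iff ctranspose_def transpose_def)

lemmas ctranspose_add = linear_add[OF bounded_linear.linear[OF bounded_linear_ctranspose]]
  and ctranspose_diff = linear_diff[OF bounded_linear.linear[OF bounded_linear_ctranspose]]
  and ctranspose_neg = linear_neg[OF bounded_linear.linear[OF bounded_linear_ctranspose]]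
  and ctranspose_sum = linear_sum[OF bounded_linear.linear[OF bounded_linear_ctranspose]]

lemma scaleCM_sum: "c *\<^sub>C (\<Sum>k\<in>K. M k) = (\<Sum>k\<in>K. c *\<^sub>C M k)"
  by (simp add: vec_eq_iff scaleCM_def sum_distrib_left)

lemma scaleCM_matrix_mult_left: "(c *\<^sub>C M) ** N = c *\<^sub>C (M ** N)"
  by (simp add: vec_eq_iff scaleCM_def matrix_matrix_mult_def sum_distrib_left mult_ac)

lemma scaleCM_matrix_mult_right: "M ** (c *\<^sub>C N) = c *\<^sub>C (M ** N)"
  by (simp add: vec_eq_iff scaleCM_def matrix_matrix_mult_def sum_distrib_left mult_ac)

lemma scaleCM_neg_left: "(- c) *\<^sub>C M = - (c *\<^sub>C M)"
  by (simp add: vec_eq_iff scaleCM_def)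

lemma ctranspose_matrix_mult: "ctranspose (M ** N) = ctranspose N ** ctranspose M"
  by (simp add: vec_eq_iff ctranspose_def transpose_def matrix_matrix_mult_def mult_ac)

lemma ctranspose_ctranspose [simp]: "ctranspose (ctranspose M) = M"
  by (simp add: vec_eq_iff ctranspose_def transpose_def)

lemma ctranspose_scaleCM: "ctranspose (c *\<^sub>C M) = cnj c *\<^sub>C ctranspose M"
  by (simp add: vec_eq_iff ctranspose_def transpose_def scaleCM_def)

lemma ctranspose_mat: "ctranspose (mat z) = mat (cnj z)"
  by (simp add: vec_eq_iff ctranspose_def transpose_def mat_def)

lemma ctranspose_gram: "ctranspose (gram B) = gram B"
  by (simp add: gram_def ctranspose_matrix_mult)

lemma ctranspose_sig_mat: "ctranspose (sig_mat k) = sig_mat k"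
  by (auto simp: vec_eq_iff ctranspose_def transpose_def sig_mat_def)

lemma sig_mat_involution: "sig_mat k ** sig_mat k = mat 1"
proof -
  have "(\<Sum>d\<in>UNIV. sig_mat k $ a $ d * sig_mat k $ d $ b) = (if a = b then 1 else 0)" for a b :: 'a
  proof -
    have "(\<Sum>d\<in>UNIV. sig_mat k $ a $ d * sig_mat k $ d $ b)
        = (\<Sum>d\<in>UNIV. if d = a then sig_mat k $ a $ a * sig_mat k $ a $ b else 0)"
      by (intro sum.cong) (auto simp: sig_mat_def)
    then show ?thesis
      by (simp add: sig_mat_def)
  qed
  then show ?thesis
    by (simp add: vec_eq_iff matrix_matrix_mult_def mat_def)
qed

section \<open>Inverses of complex matrices\<close>

lemma
  fixes M :: "complex^'n^'n"
  assumes "invertible M"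
  shows matrix_inv_right: "M ** matrix_inv M = mat 1"
    and matrix_inv_left: "matrix_inv M ** M = mat 1"
  using someI_ex[OF assms[unfolded invertible_def]] by (auto simp: matrix_inv_def)

lemma matrix_inv_eqI:
  fixes M :: "complex^'n^'n"
  assumes "M ** N = mat 1"
  shows "matrix_inv M = N"
proof -
  have "invertible M"
    using assms matrix_left_right_inverse[of M N] by (auto simp: invertible_def)
  then have "matrix_inv M ** (M ** N) = N"
    by (simp add: matrix_mul_assoc matrix_inv_left)
  then show ?thesis
    by (simp add: assms)
qed

lemma matrix_inv_ctranspose:
  fixes M :: "complex^'n^'n"
  assumes "invertible M"
  shows "matrix_inv (ctranspose M) = ctranspose (matrix_inv M)"
  by (rule matrix_inv_eqI)
    (simp add: assms ctranspose_mat matrix_inv_left flip: ctranspose_matrix_mult)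

text \<open>\<open>mspectrum\<close> is the set of eigenvalues, so a point outside it makes \<open>A - z I\<close> injective, which in
  finite dimension is enough for invertibility.\<close>

lemma invertible_resolvent:
  fixes A :: "complex^'n^'n"
  assumes "z \<notin> mspectrum A"
  shows "invertible (A - mat z)"
proof -
  have "v = 0" if "(A - mat z) *v v = 0" for v
  proof -
    have "(mat z :: complex^'n^'n) *v v = z *s v"
      by (simp add: vec_eq_iff matrix_vector_mult_def mat_def if_distrib if_distribR cong: if_cong)
    then show ?thesis
      using that assms by (auto simp: mspectrum_def matrix_vector_mult_diff_rdistrib)
  qed
  then show ?thesis
    using matrix_left_invertible_ker[of "A - mat z"] by (simp add: invertible_left_inverse)
qed

text \<open>By Cramer's rule each entry of the inverse is a quotient of two determinants, that is, of
  polynomials in the entries of the matrix.\<close>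

lemma continuous_on_matrix_inv:
  "continuous_on {M :: complex^'n^'n. invertible M} matrix_inv"
proof -
  have det: "continuous_on X (\<lambda>M. det (F M))"
    if "continuous_on X F" for X and F :: "complex^'n^'n \<Rightarrow> complex^'n^'n"
    unfolding det_def by (intro continuous_intros that)
  let ?C = "\<lambda>M::complex^'n^'n. \<chi> k l. det (\<chi> i j. if j = k then axis l 1 $ i else M $ i $ j) / det M"
  have "matrix_inv M = ?C M" if "invertible M" for M :: "complex^'n^'n"
  proof -
    have "M *v column l (matrix_inv M) = axis l 1" for l
      using matrix_inv_right[OF that]
      by (auto simp: vec_eq_iff matrix_vector_mult_def matrix_matrix_mult_def column_def mat_def
          axis_def)
    then have *: "column l (matrix_inv M)
        = (\<chi> k. det (\<chi> i j. if j = k then axis l 1 $ i else M $ i $ j) / det M)" for l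
      using cramer[of M] that by (simp add: invertible_det_nz)
    show ?thesis
      using * by (simp add: vec_eq_iff column_def)
  qed
  moreover have "continuous_on {M :: complex^'n^'n. invertible M} ?C"
  proof (intro continuous_intros det)
    show "continuous_on {M. invertible M} (\<lambda>x. if j = k then axis l 1 $ i else x $ i $ j)"
      for i j k l :: 'n
      by (cases "j = k") (auto intro!: continuous_intros)
  qed (simp add: invertible_det_nz)
  ultimately show ?thesis
    using continuous_on_eq[of "{M. invertible M}" ?C matrix_inv] by simp
qed

text \<open>This identity turns an increment of \<open>S\<^sup>-\<^sup>1\<close> into an increment of \<open>S\<close>; both the absolute
  continuity and the derivative of \<open>S\<^sup>-\<^sup>1\<close> are read off from it.\<close>

lemma matrix_inv_diff:
  fixes M N :: "complex^'n^'n"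
  assumes "invertible M" "invertible N"
  shows "matrix_inv N - matrix_inv M = - (matrix_inv N ** (N - M) ** matrix_inv M)"
proof -
  have "matrix_inv N ** (N - M) ** matrix_inv M
      = (matrix_inv N ** N) ** matrix_inv M - matrix_inv N ** (M ** matrix_inv M)"
    by (simp add: matrix_mult_diff_left matrix_mult_diff_right matrix_mul_assoc)
  then show ?thesis
    by (simp add: matrix_inv_left matrix_inv_right assms)
qed

section \<open>Absolutely continuous functions\<close>

lemma abs_cont_onE:
  fixes f :: "real \<Rightarrow> 'a::real_normed_vector"
  assumes "abs_cont_on T f" "e > 0"
  obtains \<delta> where "\<delta> > 0"
    and "\<And>\<D> t. \<D> division_of t \<Longrightarrow> t \<subseteq> T \<Longrightarrow> (\<Sum>K\<in>\<D>. measure lborel K) < \<delta>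
      \<Longrightarrow> (\<Sum>K\<in>\<D>. norm (f (Sup K) - f (Inf K))) < e"
proof -
  have "\<exists>\<delta>>0. \<forall>\<D> t. \<D> division_of t \<and> t \<subseteq> T
      \<and> (\<Sum>K\<in>\<D>. measure lborel K) < \<delta> \<longrightarrow> (\<Sum>K\<in>\<D>. norm (f (Sup K) - f (Inf K))) < e"
    using assms by (simp only: abs_cont_on_def)
  then show thesis
  proof (elim exE conjE)
    fix \<delta> :: real
    assume "\<delta> > 0" and *: "\<forall>\<D> t. \<D> division_of t \<and> t \<subseteq> T
      \<and> (\<Sum>K\<in>\<D>. measure lborel K) < \<delta> \<longrightarrow> (\<Sum>K\<in>\<D>. norm (f (Sup K) - f (Inf K))) < e"
    show thesis
      by (rule that[OF \<open>\<delta> > 0\<close> *[rule_format]]) (intro conjI)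
  qed
qed

text \<open>Absolute continuity only concerns sums of increments over a division, so it passes to every
  function whose increments are bounded by those of absolutely continuous ones. Products and
  inverses are treated by exhibiting such a bound.\<close>

lemma abs_cont_on_Lipschitz_dominated:
  fixes f :: "real \<Rightarrow> 'a::real_normed_vector" and g :: "real \<Rightarrow> 'b::real_normed_vector"
    and h :: "real \<Rightarrow> 'c::real_normed_vector"
  assumes f: "abs_cont_on T f" and g: "abs_cont_on T g"
    and le: "\<And>x y. x \<in> T \<Longrightarrow> y \<in> T \<Longrightarrow> norm (h y - h x) \<le> C * (norm (f y - f x) + norm (g y - g x))"
  shows "abs_cont_on T h"
  unfolding abs_cont_on_def
proof (intro allI impI)
  fix e :: real assume "e > 0"
  \<comment> \<open>The constant \<open>C\<close> may be zero or negative; \<open>C'\<close> is a positive majorant,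
    by which the tolerance can be divided.\<close>
  define C' where "C' = \<bar>C\<bar> + 1"
  have C': "C' > 0" "C \<le> C'"
    by (auto simp: C'_def)
  define d where "d = e / (2 * C')"
  have "d > 0"
    using \<open>e > 0\<close> C' by (simp add: d_def)
  obtain \<delta>1 where \<delta>1: "\<delta>1 > 0" and f\<delta>: "\<And>\<D> t. \<D> division_of t \<Longrightarrow> t \<subseteq> T
      \<Longrightarrow> (\<Sum>K\<in>\<D>. measure lborel K) < \<delta>1 \<Longrightarrow> (\<Sum>K\<in>\<D>. norm (f (Sup K) - f (Inf K))) < d"
    by (rule abs_cont_onE[OF f \<open>d > 0\<close>]) (rule that)
  obtain \<delta>2 where \<delta>2: "\<delta>2 > 0" and g\<delta>: "\<And>\<D> t. \<D> division_of t \<Longrightarrow> t \<subseteq> T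
      \<Longrightarrow> (\<Sum>K\<in>\<D>. measure lborel K) < \<delta>2 \<Longrightarrow> (\<Sum>K\<in>\<D>. norm (g (Sup K) - g (Inf K))) < d"
    by (rule abs_cont_onE[OF g \<open>d > 0\<close>]) (rule that)
  show "\<exists>\<delta>>0. \<forall>\<D> t. \<D> division_of t \<and> t \<subseteq> T \<and> (\<Sum>K\<in>\<D>. measure lborel K) < \<delta>
      \<longrightarrow> (\<Sum>K\<in>\<D>. norm (h (Sup K) - h (Inf K))) < e"
  proof (intro exI[of _ "min \<delta>1 \<delta>2"] conjI allI impI)
    fix \<D> t assume \<D>: "\<D> division_of t \<and> t \<subseteq> T \<and> (\<Sum>K\<in>\<D>. measure lborel K) < min \<delta>1 \<delta>2"
    have "norm (h (Sup K) - h (Inf K))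
        \<le> C' * (norm (f (Sup K) - f (Inf K)) + norm (g (Sup K) - g (Inf K)))" if "K \<in> \<D>" for K
    proof -
      have "\<D> division_of t" "t \<subseteq> T"
        using \<D> by blast+
      then have "K \<noteq> {}" "K \<subseteq> T"
        using division_ofD(2,3) that by blast+
      moreover obtain a b where "K = {a..b}"
        using division_ofD(4)[OF \<open>\<D> division_of t\<close> \<open>K \<in> \<D>\<close>] by (auto simp: cbox_interval)
      ultimately have "Inf K \<in> T" "Sup K \<in> T"
        by auto
      from le[OF this] show ?thesis
        using C'(2) by (smt (verit) mult_right_mono norm_ge_zero)
    qed
    then have "(\<Sum>K\<in>\<D>. norm (h (Sup K) - h (Inf K)))
        \<le> (\<Sum>K\<in>\<D>. C' * (norm (f (Sup K) - f (Inf K)) + norm (g (Sup K) - g (Inf K))))"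
      by (rule sum_mono)
    also have "\<dots> = C' * ((\<Sum>K\<in>\<D>. norm (f (Sup K) - f (Inf K))) + (\<Sum>K\<in>\<D>. norm (g (Sup K) - g (Inf K))))"
      by (simp add: sum_distrib_left sum.distrib distrib_left)
    also have "\<dots> < C' * (d + d)"
      using f\<delta>[of \<D> t] g\<delta>[of \<D> t] \<D> C'(1) by (intro mult_strict_left_mono add_strict_mono) auto
    also have "\<dots> = e"
      using C'(1) by (simp add: d_def field_simps)
    finally show "(\<Sum>K\<in>\<D>. norm (h (Sup K) - h (Inf K))) < e" .
  qed (use \<delta>1 \<delta>2 in auto)
qed

lemma abs_cont_on_Lipschitz_image:
  fixes f :: "real \<Rightarrow> 'a::real_normed_vector" and h :: "real \<Rightarrow> 'c::real_normed_vector"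
  assumes "abs_cont_on T f"
    and le: "\<And>x y. x \<in> T \<Longrightarrow> y \<in> T \<Longrightarrow> norm (h y - h x) \<le> C * norm (f y - f x)"
  shows "abs_cont_on T h"
  using abs_cont_on_Lipschitz_dominated[OF assms(1,1), of h "C / 2"] le by simp

text \<open>Apply the definition to the division that consists of the single interval between two nearby
  points.\<close>

lemma abs_cont_on_imp_continuous_on:
  assumes "abs_cont_on {a..b} f"
  shows "continuous_on {a..b} f"
  unfolding continuous_on_iff
proof (intro ballI allI impI)
  fix x and e :: real assume x: "x \<in> {a..b}" and "e > 0"
  obtain \<delta> where \<delta>: "\<delta> > 0" and f\<delta>: "\<And>\<D> t. \<D> division_of t \<Longrightarrow> t \<subseteq> {a..b}
      \<Longrightarrow> (\<Sum>K\<in>\<D>. measure lborel K) < \<delta> \<Longrightarrow> (\<Sum>K\<in>\<D>. norm (f (Sup K) - f (Inf K))) < e"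
    by (rule abs_cont_onE[OF assms \<open>e > 0\<close>]) (rule that)
  have "dist (f y) (f x) < e" if y: "y \<in> {a..b}" and "dist y x < \<delta>" for y
  proof -
    let ?K = "{min x y..max x y}"
    have "{?K} division_of ?K"
      using division_of_self[of "min x y" "max x y"] by simp
    moreover have "?K \<subseteq> {a..b}"
      using x y by auto
    moreover have "measure lborel ?K < \<delta>"
      using that(2) by (auto simp: dist_real_def min_def max_def)
    ultimately have "norm (f (max x y) - f (min x y)) < e"
      using f\<delta>[of "{?K}" ?K] by simp
    then show ?thesis
      by (auto simp: dist_norm min_def max_def norm_minus_commute split: if_splits)
  qed
  then show "\<exists>d>0. \<forall>x'\<in>{a..b}. dist x' x < d \<longrightarrow> dist (f x') (f x) < e"
    using \<delta> by blast
qed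

lemma abs_cont_on_bounded:
  assumes "abs_cont_on {a..b} f"
  obtains B where "B > 0" "\<And>x. x \<in> {a..b} \<Longrightarrow> norm (f x) \<le> B"
proof -
  have "bounded (f ` {a..b})"
    by (intro compact_imp_bounded compact_continuous_image abs_cont_on_imp_continuous_on assms) auto
  then show thesis
    using that by (auto simp: bounded_pos)
qed

lemma (in bounded_bilinear) abs_cont_on_bilinear:
  assumes f: "abs_cont_on {a..b} f" and g: "abs_cont_on {a..b} g"
  shows "abs_cont_on {a..b} (\<lambda>x. prod (f x) (g x))"
proof -
  obtain F where F: "F > 0" "\<And>x. x \<in> {a..b} \<Longrightarrow> norm (f x) \<le> F"
    using abs_cont_on_bounded[OF f] by metis
  obtain G where G: "G > 0" "\<And>x. x \<in> {a..b} \<Longrightarrow> norm (g x) \<le> G"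
    using abs_cont_on_bounded[OF g] by metis
  obtain K where K: "K > 0" "\<And>u v. norm (prod u v) \<le> norm u * norm v * K"
    using pos_bounded by metis
  show ?thesis
  proof (rule abs_cont_on_Lipschitz_dominated[OF f g])
    fix x y assume x: "x \<in> {a..b}" and y: "y \<in> {a..b}"
    have "prod (f y) (g y) - prod (f x) (g x) = prod (f y - f x) (g y) + prod (f x) (g y - g x)"
      by (simp add: diff_left diff_right)
    also have "norm \<dots> \<le> norm (f y - f x) * norm (g y) * K + norm (f x) * norm (g y - g x) * K"
      by (intro norm_triangle_mono K)
    also have "\<dots> \<le> norm (f y - f x) * (F + G) * K + (F + G) * norm (g y - g x) * K"
      using F(2)[OF x] G(2)[OF y] K(1) F(1) G(1)
      by (intro add_mono mult_right_mono mult_left_mono) auto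
    also have "\<dots> = ((F + G) * K) * (norm (f y - f x) + norm (g y - g x))"
      by (simp add: algebra_simps)
    finally show "norm (prod (f y) (g y) - prod (f x) (g x))
      \<le> ((F + G) * K) * (norm (f y - f x) + norm (g y - g x))" .
  qed
qed

text \<open>A covering argument. Outside a null set \<open>N\<close> every short interval around a point \<open>x\<close> has an
  increment of \<open>f\<close> that is at most \<open>\<eta>\<close> times its length. The set \<open>N\<close> itself lies in an open set \<open>U\<close> of
  measure below the threshold \<open>\<delta>\<close> of absolute continuity. A gauge that respects both facts has a fine
  tagged division of \<open>{a..b}\<close>: the intervals tagged outside \<open>N\<close> contribute at most \<open>\<eta> (b - a)\<close> to
  \<open>f b - f a\<close>, and those tagged in \<open>N\<close> form a division inside \<open>U\<close> and contribute at most \<open>e / 2\<close>.\<close>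

lemma abs_cont_on_zero_derivative:
  fixes f :: "real \<Rightarrow> 'a::real_normed_vector"
  assumes "a \<le> b" and ac: "abs_cont_on {a..b} f"
    and der: "AE x in lebesgue. x \<in> {a..b} \<longrightarrow> (f has_vector_derivative 0) (at x within {a..b})"
  shows "f b = f a"
proof -
  have "norm (f b - f a) \<le> e" if "e > 0" for e
  proof -
    \<comment> \<open>The summand \<open>1\<close> keeps the denominator positive when \<open>a = b\<close>.\<close>
    define \<eta> where "\<eta> = e / (2 * (b - a + 1))"
    have \<eta>: "\<eta> > 0" "\<eta> * (b - a) \<le> e / 2"
      using \<open>a \<le> b\<close> \<open>e > 0\<close> by (auto simp: \<eta>_def field_simps)
    define N where "N = {x \<in> {a..b}. \<not> (f has_vector_derivative 0) (at x within {a..b})}"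
    have "N \<in> null_sets lebesgue"
    proof -
      obtain N' where "N' \<in> null_sets lebesgue"
        "{x. \<not> (x \<in> {a..b} \<longrightarrow> (f has_vector_derivative 0) (at x within {a..b}))} \<subseteq> N'"
        using der unfolding eventually_ae_filter by auto
      then show ?thesis
        using null_sets_completion_subset[of N N' lborel] by (auto simp: N_def)
    qed
    obtain \<delta> where \<delta>: "\<delta> > 0" and f\<delta>: "\<And>\<D> t. \<D> division_of t \<Longrightarrow> t \<subseteq> {a..b}
      \<Longrightarrow> (\<Sum>K\<in>\<D>. measure lborel K) < \<delta> \<Longrightarrow> (\<Sum>K\<in>\<D>. norm (f (Sup K) - f (Inf K))) < e / 2"
      by (rule abs_cont_onE[OF ac half_gt_zero[OF \<open>e > 0\<close>]]) (rule that)
    obtain U where U: "open U" "N \<subseteq> U" "emeasure lebesgue U < \<delta>"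
    proof -
      obtain U where U: "open U" "N \<subseteq> U" "U - N \<in> lmeasurable" "emeasure lebesgue (U - N) < \<delta>"
        using sets_lebesgue_outer_open[of N \<delta>] \<delta> \<open>N \<in> null_sets lebesgue\<close> by auto
      have "emeasure lebesgue U = emeasure lebesgue (U - N)"
        using emeasure_Diff_null_set[OF \<open>N \<in> null_sets lebesgue\<close>, of U] U(1) by simp
      with U that show thesis by metis
    qed
    have "\<exists>r>0. (x \<in> N \<longrightarrow> ball x r \<subseteq> U) \<and>
        (x \<in> {a..b} - N \<longrightarrow> (\<forall>y\<in>{a..b}. \<bar>y - x\<bar> < r \<longrightarrow> norm (f y - f x) \<le> \<eta> * \<bar>y - x\<bar>))" for x
    proof (cases "x \<in> {a..b} - N")
      case True
      then have "(f has_derivative (\<lambda>h. 0)) (at x within {a..b})"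
        by (auto simp: N_def has_vector_derivative_def)
      with \<eta>(1) obtain r where "r > 0" "\<forall>y\<in>{a..b}. norm (y - x) < r \<longrightarrow>
          norm (f y - f x - 0) \<le> \<eta> * norm (y - x)"
        unfolding has_derivative_within_alt by blast
      with True show ?thesis
        by auto
    next
      case False
      then show ?thesis
        using U(1,2) by (meson openE subsetD zero_less_one)
    qed
    then obtain r where r: "\<And>x. r x > 0" "\<And>x. x \<in> N \<Longrightarrow> ball x (r x) \<subseteq> U"
        "\<And>x y. x \<in> {a..b} - N \<Longrightarrow> y \<in> {a..b} \<Longrightarrow> \<bar>y - x\<bar> < r x \<Longrightarrow> norm (f y - f x) \<le> \<eta> * \<bar>y - x\<bar>"
      by metis
    obtain p where p: "p tagged_division_of {a..b}" and fine: "(\<lambda>x. ball x (r x)) fine p"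
      using fine_division_exists_real[of "\<lambda>x. ball x (r x)" a b] r(1) gauge_ball_dependent by blast
    let ?d = "\<lambda>K. norm (f (Sup K) - f (Inf K))"
    define q where "q = {(x, K) \<in> p. x \<in> N}"
    have "finite p"
      using p by auto
    have tag: "\<exists>u v. K = {u..v} \<and> u \<le> x \<and> x \<le> v \<and> {u..v} \<subseteq> {a..b} \<and> {u..v} \<subseteq> ball x (r x)"
      if "(x, K) \<in> p" for x K
      using tagged_division_ofD(2,3,4)[OF p that] fine that unfolding fine_def by fastforce
    have good: "(\<Sum>(x,K)\<in>p - q. ?d K) \<le> e / 2"
    proof -
      have "?d K \<le> \<eta> * measure lborel K" if xK: "(x, K) \<in> p - q" for x K
      proof -
        obtain u v where uv: "K = {u..v}" "u \<le> x" "x \<le> v" "{u..v} \<subseteq> {a..b}" "{u..v} \<subseteq> ball x (r x)"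
          using tag xK by blast
        have x: "x \<in> {a..b} - N"
          using xK uv by (auto simp: q_def)
        have "u \<in> {u..v}" "v \<in> {u..v}"
          using uv by auto
        then have "u \<in> {a..b}" "u \<in> ball x (r x)" "v \<in> {a..b}" "v \<in> ball x (r x)"
          using uv(4,5) by blast+
        then have "norm (f u - f x) \<le> \<eta> * (x - u)" "norm (f v - f x) \<le> \<eta> * (v - x)"
          using r(3)[OF x, of u] r(3)[OF x, of v] uv(2,3)
          by (simp_all add: dist_real_def abs_minus_commute)
        then have "norm (f v - f u) \<le> \<eta> * (v - u)"
          using norm_triangle_ineq4[of "f v - f x" "f u - f x"] by (simp add: algebra_simps)
        then show ?thesis
          using uv by simp
      qed
      then have "(\<Sum>(x,K)\<in>p - q. ?d K) \<le> (\<Sum>(x,K)\<in>p - q. \<eta> * measure lborel K)"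
        by (intro sum_mono) auto
      also have "\<dots> \<le> (\<Sum>(x,K)\<in>p. \<eta> * measure lborel K)"
        using \<eta>(1) \<open>finite p\<close> by (intro sum_mono2) auto
      also have "\<dots> = \<eta> * (b - a)"
        using additive_content_tagged_division[of p a b] p \<open>a \<le> b\<close>
        by (simp add: case_prod_unfold flip: sum_distrib_left)
      finally show ?thesis
        using \<eta>(2) by simp
    qed
    have bad: "(\<Sum>(x,K)\<in>q. ?d K) \<le> e / 2"
    proof -
      have "q tagged_partial_division_of {a..b}"
        using p by (auto simp: q_def tagged_division_of_def intro: tagged_partial_division_subset)
      note q = tagged_partial_division_of_Union_self[OF this]
      note D = division_of_tagged_division[OF q]
      have sub: "\<Union>(snd ` q) \<subseteq> {a..b}" "\<Union>(snd ` q) \<subseteq> U"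
        using tag r(2) by (fastforce simp: q_def)+
      have nonempty: "K \<noteq> {}" if "(x, K) \<in> q" for x K
        using tagged_division_ofD(2)[OF q that] by blast
      \<comment> \<open>Two tags may share a degenerate interval, so the sum over \<open>q\<close> becomes a sum over the intervals
      only for a summand that vanishes on all degenerate ones. On the empty interval \<open>Sup\<close> and \<open>Inf\<close>
      are arbitrary, hence the case distinction.\<close>
      let ?d' = "\<lambda>K. if K = {} then 0 else ?d K"
      have "(\<Sum>(x,K)\<in>q. ?d K) = (\<Sum>(x,K)\<in>q. ?d' K)"
        using nonempty by (intro sum.cong) auto
      also have "\<dots> = (\<Sum>K\<in>snd ` q. ?d' K)"
      proof (rule sum.over_tagged_division_lemma[OF q])
        fix u v :: real assume "box u v = {}"
        then show "?d' (cbox u v) = 0"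
          by (cases "u = v") auto
      qed
      also have "\<dots> = (\<Sum>K\<in>snd ` q. ?d K)"
        using nonempty by (intro sum.cong) auto
      also have "\<dots> < e / 2"
      proof (rule f\<delta>[OF D sub(1)])
        have "(\<Sum>K\<in>snd ` q. measure lborel K) = (\<Sum>K\<in>snd ` q. measure lebesgue K)"
        proof (rule sum.cong)
          fix K assume "K \<in> snd ` q"
          then obtain u v where "K = cbox u v"
            using division_ofD(4)[OF D] by blast
          then show "measure lborel K = measure lebesgue K"
            by simp
        qed simp
        also have "\<dots> = measure lebesgue (\<Union>(snd ` q))"
          by (rule content_division[OF D])
        also have "\<dots> < \<delta>"
        proof -
          have "emeasure lebesgue (\<Union>(snd ` q)) \<le> emeasure lebesgue U"
            using sub(2) U(1) by (intro emeasure_mono) auto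
          also note U(3)
          finally show ?thesis
            using lmeasurable_division[OF D] \<delta>
            by (simp add: emeasure_eq_measure2 ennreal_less_iff)
        qed
        finally show "(\<Sum>K\<in>snd ` q. measure lborel K) < \<delta>" .
      qed
      finally show ?thesis by simp
    qed
    have "f b - f a = (\<Sum>(x,K)\<in>p. f (Sup K) - f (Inf K))"
      using additive_tagged_division_1[OF \<open>a \<le> b\<close> p, of f] by simp
    also have "norm \<dots> \<le> (\<Sum>(x,K)\<in>p. ?d K)"
      by (rule order_trans[OF norm_sum]) (simp add: case_prod_unfold)
    also have "\<dots> = (\<Sum>(x,K)\<in>p - q. ?d K) + (\<Sum>(x,K)\<in>q. ?d K)"
      using \<open>finite p\<close> by (intro sum.subset_diff) (auto simp: q_def)
    finally show ?thesis
      using good bad by simp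
  qed
  then have "norm (f b - f a) \<le> 0"
    by (meson field_le_epsilon add_0 less_eq_real_def field_lbound_gt_zero linorder_not_le)
  then show ?thesis by simp
qed

section \<open>Calculus of almost everywhere derivatives\<close>

lemma ae_ode_on_subset:
  assumes "ae_ode_on X f g" "Y \<subseteq> X"
  shows "ae_ode_on Y f g"
proof -
  have "AE x in lebesgue. x \<in> Y \<longrightarrow> (f has_vector_derivative g x) (at x within Y)"
    using assms unfolding ae_ode_on_def
    by (auto elim!: eventually_mono intro: has_vector_derivative_within_subset)
  then show ?thesis
    using assms unfolding ae_ode_on_def loc_abs_cont_on_def by blast
qed

lemma ae_ode_on_cong:
  assumes "ae_ode_on X f g" "\<And>x. x \<in> X \<Longrightarrow> g x = g' x"
  shows "ae_ode_on X f g'"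
  using assms unfolding ae_ode_on_def by (auto elim!: eventually_mono)

lemma (in bounded_linear) ae_ode_on_linear:
  assumes "ae_ode_on X g g'"
  shows "ae_ode_on X (\<lambda>x. f (g x)) (\<lambda>x. f (g' x))"
proof -
  obtain K where K: "\<And>x. norm (f x) \<le> norm x * K"
    using bounded by metis
  have "abs_cont_on {a..b} (\<lambda>x. f (g x))" if "abs_cont_on {a..b} g" for a b
    using K by (intro abs_cont_on_Lipschitz_image[OF that, where C = K])
      (simp add: mult.commute flip: diff)
  then show ?thesis
    using assms unfolding ae_ode_on_def loc_abs_cont_on_def
    by (auto elim!: eventually_mono intro: has_vector_derivative)
qed

lemma (in bounded_bilinear) ae_ode_on_bilinear:
  assumes f: "ae_ode_on X f f'" and g: "ae_ode_on X g g'"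
  shows "ae_ode_on X (\<lambda>x. prod (f x) (g x)) (\<lambda>x. prod (f x) (g' x) + prod (f' x) (g x))"
proof -
  have "AE x in lebesgue. x \<in> X \<longrightarrow> ((\<lambda>x. prod (f x) (g x)) has_vector_derivative
      prod (f x) (g' x) + prod (f' x) (g x)) (at x within X)"
  proof -
    have "AE x in lebesgue. x \<in> X \<longrightarrow> (f has_vector_derivative f' x) (at x within X)"
      "AE x in lebesgue. x \<in> X \<longrightarrow> (g has_vector_derivative g' x) (at x within X)"
      using f g by (auto simp: ae_ode_on_def)
    then show ?thesis
      by eventually_elim (auto intro: has_vector_derivative)
  qed
  then show ?thesis
    using f g unfolding ae_ode_on_def loc_abs_cont_on_def by (auto intro: abs_cont_on_bilinear)
qed

lemma ae_ode_on_zero_imp_constant: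
  assumes "ae_ode_on I f (\<lambda>x. 0)" "is_interval I" "x \<in> I" "y \<in> I"
  shows "f x = f y"
proof -
  have *: "f b = f a" if "a \<le> b" "a \<in> I" "b \<in> I" for a b
  proof -
    have "{a..b} \<subseteq> I"
      using mem_is_interval_1_I[OF assms(2) \<open>a \<in> I\<close> \<open>b \<in> I\<close>] by auto
    then have "ae_ode_on {a..b} f (\<lambda>x. 0)"
      using ae_ode_on_subset assms(1) by blast
    then show ?thesis
      unfolding ae_ode_on_def loc_abs_cont_on_def
      using abs_cont_on_zero_derivative[OF \<open>a \<le> b\<close>] by blast
  qed
  show ?thesis
    using *[of x y] *[of y x] assms(3,4) by (metis linear)
qed

text \<open>The derivative of an inverse is obtained by passing to the limit in a product of difference
  quotients, which calls for the derivative as a limit of quotients.\<close>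

lemma has_vector_derivative_iff_quotient:
  "(f has_vector_derivative D) (at x within X)
    \<longleftrightarrow> ((\<lambda>y. (f y - f x) /\<^sub>R (y - x)) \<longlongrightarrow> D) (at x within X)"
proof -
  have "(f has_vector_derivative D) (at x within X)
      \<longleftrightarrow> ((\<lambda>y. norm (f y - f x - (y - x) *\<^sub>R D) / norm (y - x)) \<longlongrightarrow> 0) (at x within X)"
    by (simp add: has_vector_derivative_def has_derivative_iff_norm bounded_linear_scaleR_left)
  also have "\<dots> \<longleftrightarrow> ((\<lambda>y. norm ((f y - f x) /\<^sub>R (y - x) - D)) \<longlongrightarrow> 0) (at x within X)"
  proof (rule Lim_cong_within)
    fix y assume "y \<noteq> x"
    have "(f y - f x) /\<^sub>R (y - x) - D = (f y - f x - (y - x) *\<^sub>R D) /\<^sub>R (y - x)"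
      using \<open>y \<noteq> x\<close> by (simp add: scaleR_diff_right)
    then show "norm (f y - f x - (y - x) *\<^sub>R D) / norm (y - x) = norm ((f y - f x) /\<^sub>R (y - x) - D)"
      by (simp add: divide_inverse mult.commute)
  qed simp_all
  finally show ?thesis
    by (simp only: tendsto_norm_zero_iff LIM_zero_iff)
qed

text \<open>Both parts use \<open>S(y)\<^sup>-\<^sup>1 - S(x)\<^sup>-\<^sup>1 = - S(y)\<^sup>-\<^sup>1 (S(y) - S(x)) S(x)\<^sup>-\<^sup>1\<close>. On a compact interval the
  inverses are bounded by continuity, so the increments of \<open>S\<^sup>-\<^sup>1\<close> are dominated by those of \<open>S\<close>;
  division by \<open>y - x\<close> and \<open>y \<rightarrow> x\<close> give the derivative.\<close>

lemma ae_ode_on_matrix_inv: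
  fixes S :: "real \<Rightarrow> complex^'n^'n"
  assumes S: "ae_ode_on X S S'" and inv: "\<And>x. x \<in> X \<Longrightarrow> invertible (S x)"
  shows "ae_ode_on X (\<lambda>x. matrix_inv (S x)) (\<lambda>x. - (matrix_inv (S x) ** S' x ** matrix_inv (S x)))"
  unfolding ae_ode_on_def loc_abs_cont_on_def
proof (intro conjI allI impI)
  fix a b assume ab: "{a..b} \<subseteq> X"
  then have ac: "abs_cont_on {a..b} S"
    using S by (auto simp: ae_ode_on_def loc_abs_cont_on_def)
  have "continuous_on {a..b} (\<lambda>x. matrix_inv (S x))"
    by (rule continuous_on_compose2[OF continuous_on_matrix_inv abs_cont_on_imp_continuous_on[OF ac]])
      (use ab inv in auto)
  then have "bounded ((\<lambda>x. matrix_inv (S x)) ` {a..b})"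
    by (intro compact_imp_bounded compact_continuous_image) auto
  then obtain B where B: "B > 0" "\<And>x. x \<in> {a..b} \<Longrightarrow> norm (matrix_inv (S x)) \<le> B"
    by (auto simp: bounded_pos)
  obtain K where K: "K > 0" "\<And>(M :: complex^'n^'n) (N :: complex^'n^'n). norm (M ** N) \<le> norm M * norm N * K"
    using bounded_bilinear.pos_bounded[OF bounded_bilinear_matrix_mult] by metis
  show "abs_cont_on {a..b} (\<lambda>x. matrix_inv (S x))"
  proof (rule abs_cont_on_Lipschitz_image[OF ac])
    fix x y assume x: "x \<in> {a..b}" and y: "y \<in> {a..b}"
    have "norm (matrix_inv (S y) - matrix_inv (S x))
        = norm (matrix_inv (S y) ** (S y - S x) ** matrix_inv (S x))"
      using matrix_inv_diff[OF inv[OF subsetD[OF ab x]] inv[OF subsetD[OF ab y]]] by simp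
    also have "\<dots> \<le> norm (matrix_inv (S y) ** (S y - S x)) * norm (matrix_inv (S x)) * K"
      by (rule K)
    also have "\<dots> \<le> (norm (matrix_inv (S y)) * norm (S y - S x) * K) * norm (matrix_inv (S x)) * K"
      using K by (intro mult_right_mono) auto
    also have "\<dots> \<le> (B * norm (S y - S x) * K) * B * K"
      using B K(1) x y by (intro mult_right_mono mult_mono) auto
    finally show "norm (matrix_inv (S y) - matrix_inv (S x)) \<le> (B * K * B * K) * norm (S y - S x)"
      by (simp add: mult_ac)
  qed
next
  have "((\<lambda>x. matrix_inv (S x)) has_vector_derivative
      - (matrix_inv (S x) ** S' x ** matrix_inv (S x))) (at x within X)"
    if x: "x \<in> X" and d: "(S has_vector_derivative S' x) (at x within X)" for x
    unfolding has_vector_derivative_iff_quotient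
  proof (rule Lim_transform_within)
    have "(S \<longlongrightarrow> S x) (at x within X)"
      using has_vector_derivative_continuous[OF d] by (simp add: continuous_within)
    then have "((\<lambda>y. matrix_inv (S y)) \<longlongrightarrow> matrix_inv (S x)) (at x within X)"
      using inv x
      by (intro continuous_on_tendsto_compose[OF continuous_on_matrix_inv])
        (auto simp: eventually_at_filter)
    then show "((\<lambda>y. - (matrix_inv (S y) ** ((S y - S x) /\<^sub>R (y - x)) ** matrix_inv (S x))) \<longlongrightarrow>
        - (matrix_inv (S x) ** S' x ** matrix_inv (S x))) (at x within X)"
      using d unfolding has_vector_derivative_iff_quotient
      by (intro tendsto_minus bounded_bilinear.tendsto[OF bounded_bilinear_matrix_mult]
          tendsto_const)
    fix y assume "y \<in> X"
    then show "- (matrix_inv (S y) ** ((S y - S x) /\<^sub>R (y - x)) ** matrix_inv (S x))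
        = (matrix_inv (S y) - matrix_inv (S x)) /\<^sub>R (y - x)"
      using matrix_inv_diff[OF inv[OF x] inv[OF \<open>y \<in> X\<close>]]
      by (simp add: bounded_bilinear.scaleR_left[OF bounded_bilinear_matrix_mult]
          bounded_bilinear.scaleR_right[OF bounded_bilinear_matrix_mult])
  qed (rule zero_less_one)
  then show "AE x in lebesgue. x \<in> X \<longrightarrow> ((\<lambda>x. matrix_inv (S x)) has_vector_derivative
      - (matrix_inv (S x) ** S' x ** matrix_inv (S x))) (at x within X)"
    using S unfolding ae_ode_on_def by (auto elim!: eventually_mono)
qed

section \<open>The derivative of \<open>P\<^sup>* S\<^sup>-\<^sup>1 P\<close>\<close>

text \<open>Since \<open>j\<^sup>2 = I\<close> and \<open>X\<close> is Hermitian, \<open>j w\<^sup>* j = I + i j P\<^sup>* R\<^sup>* X P\<close>; the three terms on the right are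
  the two mixed terms and the quadratic term of the Gram matrix of \<open>B (j w\<^sup>* j)\<close>.\<close>

lemma gram_beta_tilde_minus_gram:
  fixes A S :: "complex^'n^'n" and P :: "complex^'m^'n" and j :: "complex^'m^'m"
    and B :: "complex^'m^'p" and c :: complex
  defines "X \<equiv> matrix_inv S" and "R \<equiv> matrix_inv (A - mat c)"
  assumes "invertible S" and "ctranspose S = S" and jj: "j ** j = mat 1" and cj: "ctranspose j = j"
  shows "gram (beta_tilde A j S P c B) - gram B
    = \<i> *\<^sub>C (gram B ** j ** ctranspose P ** ctranspose R ** X ** P)
      - \<i> *\<^sub>C (ctranspose P ** X ** R ** P ** j ** gram B)
      + ctranspose P ** X ** R ** P ** j ** gram B ** j ** ctranspose P ** ctranspose R ** X ** P"
proof -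
  have jj': "M ** j ** j = M" for M :: "complex^'m^'q"
    by (simp add: jj flip: matrix_mul_assoc)
  have cX: "ctranspose X = X"
    using matrix_inv_ctranspose[OF assms(3)] by (simp add: X_def assms(4))
  have bt: "beta_tilde A j S P c B = B + \<i> *\<^sub>C (B ** j ** ctranspose P ** ctranspose R ** X ** P)"
    unfolding beta_tilde_def transfer_mat_def X_def[symmetric] R_def[symmetric]
    by (simp add: ctranspose_diff ctranspose_scaleCM ctranspose_matrix_mult ctranspose_mat cX cj
        matrix_mult_diff_left matrix_mult_diff_right scaleCM_matrix_mult_left
        scaleCM_matrix_mult_right matrix_mul_assoc jj')
      (simp add: vec_eq_iff scaleCM_def)
  show ?thesis
    unfolding bt gram_def
    by (simp add: ctranspose_add ctranspose_scaleCM ctranspose_matrix_mult cX cj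
        matrix_mult_add_left matrix_mult_add_right scaleCM_matrix_mult_left
        scaleCM_matrix_mult_right matrix_mul_assoc)
      (simp add: vec_eq_iff scaleCM_def right_diff_distrib flip: mult.assoc)
qed

theorem proposition4p4:
  fixes r m1 m2 :: nat
    and c :: "nat \<Rightarrow> real"
    and j :: "complex^('m::{finite,linorder})^('m::{finite,linorder})"
    and I :: "real set"
    and \<beta> :: "nat \<Rightarrow> real \<Rightarrow> complex^('m::{finite,linorder})^'p"
    and H :: "nat \<Rightarrow> real \<Rightarrow> complex^('m::{finite,linorder})^('m::{finite,linorder})"
    and A :: "complex^'n^'n"
    and S :: "real \<Rightarrow> complex^'n^'n"
    and P :: "real \<Rightarrow> complex^('m::{finite,linorder})^'n"
  assumes "r \<ge> 1"
    and "inj_on c {1..r}"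
    and "CARD('m) = m1 + m2"
    and "j = sig_mat m1"
    and "CARD('p) \<le> CARD('m)"
    and "is_interval I" and "0 \<in> I"
    and "\<And>k x. H k x = gram (\<beta> k x)"
    and "\<And>k. k \<in> {1..r} \<Longrightarrow> loc_summable_on I (H k)"
    and "\<And>k. k \<in> {1..r} \<Longrightarrow> complex_of_real (c k) \<notin> mspectrum A"
    and "A ** S 0 - S 0 ** ctranspose A = \<i> *\<^sub>C (P 0 ** j ** ctranspose (P 0))"
    and "S 0 = ctranspose (S 0)"
    and "ae_ode_on I P (\<lambda>x. - (\<i> *\<^sub>C
           (\<Sum>k=1..r. matrix_inv (A - mat (c k)) ** P x ** j ** H k x)))"
    and "ae_ode_on I S (\<lambda>x. -
           (\<Sum>k=1..r. matrix_inv (A - mat (c k)) ** P x ** j ** H k x ** j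
              ** ctranspose (P x) ** matrix_inv (ctranspose A - mat (c k))))"
  shows "ae_ode_on {x \<in> I. invertible (S x)}
           (\<lambda>x. ctranspose (P x) ** matrix_inv (S x) ** P x)
           (\<lambda>x. \<Sum>k=1..r. (gram (beta_tilde A j (S x) (P x) (c k) (\<beta> k x)) - H k x))"
proof -
  define R where "R k = matrix_inv (A - mat (complex_of_real (c k)))" for k
  define Q where "Q k x = R k ** P x ** j ** H k x" for k x
  define P' where "P' x = - (\<i> *\<^sub>C (\<Sum>k=1..r. Q k x))" for x
  define S' where "S' x = - (\<Sum>k=1..r. Q k x ** j ** ctranspose (P x) ** ctranspose (R k))" for x
  have cj: "ctranspose j = j" and jj: "j ** j = mat 1"
    using \<open>j = sig_mat m1\<close> by (simp_all add: ctranspose_sig_mat sig_mat_involution)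
  have cH: "ctranspose (H k x) = H k x" for k x
    using assms(8) by (simp add: ctranspose_gram)
  have T: "matrix_inv (ctranspose A - mat (complex_of_real (c k))) = ctranspose (R k)"
    if "k \<in> {1..r}" for k
    using matrix_inv_ctranspose[OF invertible_resolvent[OF assms(10)[OF that]]]
    by (simp add: R_def ctranspose_diff ctranspose_mat)
  have odeP: "ae_ode_on I P P'"
    using assms(13) by (simp add: P'_def[abs_def] Q_def R_def)
  have odeS: "ae_ode_on I S S'"
  proof (rule ae_ode_on_cong[OF assms(14)])
    show "- (\<Sum>k=1..r. matrix_inv (A - mat (c k)) ** P x ** j ** H k x ** j
        ** ctranspose (P x) ** matrix_inv (ctranspose A - mat (c k))) = S' x" for x
      unfolding S'_def neg_equal_iff_equal
      by (rule sum.cong) (simp_all only: Q_def T R_def)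
  qed
  \<comment> \<open>The initial value is Hermitian and the anti-Hermitian part of \<open>S\<close> has zero derivative.\<close>
  have "S x - ctranspose (S x) = S 0 - ctranspose (S 0)" if "x \<in> I" for x
  proof (rule ae_ode_on_zero_imp_constant[OF _ \<open>is_interval I\<close> that \<open>0 \<in> I\<close>])
    have "ae_ode_on I (\<lambda>x. S x - ctranspose (S x)) (\<lambda>x. S' x - ctranspose (S' x))"
      by (rule bounded_linear.ae_ode_on_linear[OF _ odeS])
        (intro bounded_linear_sub bounded_linear_ident bounded_linear_ctranspose)
    moreover have "ctranspose (S' x) = S' x" for x
      by (simp add: S'_def Q_def ctranspose_neg ctranspose_sum ctranspose_matrix_mult cj cH
          matrix_mul_assoc)
    ultimately show "ae_ode_on I (\<lambda>x. S x - ctranspose (S x)) (\<lambda>x. 0)"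
      by simp
  qed
  then have cS: "ctranspose (S x) = S x" if "x \<in> I" for x
    using that \<open>S 0 = ctranspose (S 0)\<close> by simp
  let ?X = "{x \<in> I. invertible (S x)}"
  have P: "ae_ode_on ?X P P'" and S: "ae_ode_on ?X S S'"
    using ae_ode_on_subset[OF odeP] ae_ode_on_subset[OF odeS] by auto
  note ode = bounded_bilinear.ae_ode_on_bilinear[OF bounded_bilinear_matrix_mult
    bounded_bilinear.ae_ode_on_bilinear[OF bounded_bilinear_matrix_mult
      bounded_linear.ae_ode_on_linear[OF bounded_linear_ctranspose P]
      ae_ode_on_matrix_inv[OF S]] P]
  show ?thesis
  proof (rule ae_ode_on_cong[OF ode])
    fix x assume x: "x \<in> ?X"
    define X where "X = matrix_inv (S x)"
    have "gram (beta_tilde A j (S x) (P x) (c k) (\<beta> k x)) - H k x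
      = \<i> *\<^sub>C (H k x ** j ** ctranspose (P x) ** ctranspose (R k) ** X ** P x)
      - \<i> *\<^sub>C (ctranspose (P x) ** X ** Q k x)
      + ctranspose (P x) ** X ** Q k x ** j ** ctranspose (P x) ** ctranspose (R k) ** X ** P x" for k
      using gram_beta_tilde_minus_gram[of "S x" j A "P x" "c k" "\<beta> k x"] x cS cj jj
      by (simp add: X_def R_def Q_def assms(8) matrix_mul_assoc)
    moreover have "ctranspose (Q k x) = H k x ** j ** ctranspose (P x) ** ctranspose (R k)" for k
      by (simp add: Q_def ctranspose_matrix_mult cj cH matrix_mul_assoc)
    ultimately show "ctranspose (P x) ** matrix_inv (S x) ** P' x
        + (ctranspose (P x) ** - (matrix_inv (S x) ** S' x ** matrix_inv (S x))
           + ctranspose (P' x) ** matrix_inv (S x)) ** P x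
      = (\<Sum>k=1..r. gram (beta_tilde A j (S x) (P x) (c k) (\<beta> k x)) - H k x)"
      unfolding X_def[symmetric] P'_def S'_def
      by (simp add: ctranspose_neg ctranspose_sum ctranspose_scaleCM scaleCM_sum
          matrix_mult_add_left matrix_mult_add_right matrix_mult_minus_left
          matrix_mult_minus_right matrix_mult_sum_left matrix_mult_sum_right
          scaleCM_matrix_mult_left scaleCM_matrix_mult_right matrix_mul_assoc
          sum.distrib sum_subtractf scaleCM_neg_left sum_negf)
  qed auto
qed

end
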